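(* Let $0<t<1$ and let $M_n=\begin{pmatrix}\mathcal R&\mathcal Q\\ \mathcal Q&\mathcal R\end{pmatrix}$ be the $2n\times 2n$ dimer matrix with parameter $t$ (defined in the context). Then for every $n\ge1$, $$\det M_n=\det T_n(\phi),\qquad \phi=\begin{pmatrix}c&d\\ \tilde d&\tilde c\end{pmatrix},$$ where $$c(e^{ix})=\frac{t\cos x+\sin^2x}{(t-e^{-ix})\sqrt{t^2+\sin^2x+\sin^4x}},\qquad d(e^{ix})=\frac{\sin x}{\sqrt{t^2+\sin^2x+\sin^4x}}.$$
   Context: For a function $a$ on the unit circle, $\tilde a(e^{ix})=a(e^{-ix})$. For an $N\times N$ matrix valued function $\phi$ on the unit circle with Fourier coefficients $\phi_k=\frac1{2\pi}\int_0^{2\pi}\phi(e^{ix})e^{-ikx}\,dx\in\mathbb C^{N\times N}$, $T_n(\phi)=(\phi_{j-k})_{0\le j,k\le n-1}$ is the finite block Toeplitz matrix (of size $nN\times nN$). The blocks $\mathcal R,\mathcal Q$ of $M_n$ are the $n\times n$ matrices with entries, for $1\le j,k\le n$, $$\mathcal R_{jk}=2(-1)^{[(k-j)/2]}R_{k-j+1}+\theta(j-k)\,t^{\,j-k-1},\qquad \mathcal Q_{jk}=2i(-1)^{[(j+k)/2]}Q_{n+1-j-k},$$ where $[\cdot]$ is the integer part (floor), $\theta(k)=1$ for $k>0$ and $\theta(k)=0$ otherwise, and for integers $k$: for even $k$: $Q_k=0$ and $$R_k=\frac1{8\pi^2}\int_{-\pi}^{\pi}\int_{-\pi}^{\pi}\frac{\cos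 y\,\cos(kx+y)}{\cos^2x+\cos^2y+t^2\cos^2(x+y)}\,dy\,dx;$$ for odd $k$: $$Q_k=\frac1{8\pi^2}\int_{-\pi}^{\pi}\int_{-\pi}^{\pi}\frac{\cos x\,\cos kx}{\cos^2x+\cos^2y+t^2\cos^2(x+y)}\,dy\,dx,$$ $$R_k=\frac t{8\pi^2}\int_{-\pi}^{\pi}\int_{-\pi}^{\pi}\frac{\cos(x+y)\cos(kx+y)}{\cos^2x+\cos^2y+t^2\cos^2(x+y)}\,dy\,dx.$$ *)

theory Defs
  imports "HOL-Analysis.Analysis" "Jordan_Normal_Form.Determinant"
begin

text \<open>
  Functions on the unit circle are total functions on \<^typ>\<open>complex\<close>. Only their values at points
  \<open>cis x\<close>, i.e. $e^{ix}$, enter the definitions below.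
  The names \<open>mat\<close> and \<open>det\<close> are qualified because HOL-Analysis uses them
  for type-indexed matrices.
\<close>

definition reflect :: "(complex \<Rightarrow> 'a) \<Rightarrow> complex \<Rightarrow> 'a" where
  "reflect a z = a (cnj z)"

lemma reflect_cis: "reflect a (cis x) = a (cis (- x))"
  by (simp add: reflect_def cis_cnj)

definition fourier_coeff :: "nat \<Rightarrow> (complex \<Rightarrow> complex mat) \<Rightarrow> int \<Rightarrow> complex mat" where
  "fourier_coeff N \<phi> k = Matrix.mat N N (\<lambda>(a, b).
     1 / (2 * of_real pi) * integral {0..2 * pi} (\<lambda>x. \<phi> (cis x) $$ (a, b) * cis (- (of_int k * x))))"

definition block_toeplitz :: "nat \<Rightarrow> nat \<Rightarrow> (complex \<Rightarrow> complex mat) \<Rightarrow> complex mat" where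
  "block_toeplitz N n \<phi> = Matrix.mat (n * N) (n * N) (\<lambda>(p, q).
     fourier_coeff N \<phi> (int (p div N) - int (q div N)) $$ (p mod N, q mod N))"

definition dimer_denom :: "real \<Rightarrow> real \<Rightarrow> real \<Rightarrow> real" where
  "dimer_denom t x y = (cos x)\<^sup>2 + (cos y)\<^sup>2 + t\<^sup>2 * (cos (x + y))\<^sup>2"

definition dimer_R :: "real \<Rightarrow> int \<Rightarrow> real" where
  "dimer_R t k =
    (if even k
     then 1 / (8 * pi\<^sup>2) * integral {- pi..pi} (\<lambda>x. integral {- pi..pi} (\<lambda>y.
            cos y * cos (of_int k * x + y) / dimer_denom t x y))
     else t / (8 * pi\<^sup>2) * integral {- pi..pi} (\<lambda>x. integral {- pi..pi} (\<lambda>y.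
            cos (x + y) * cos (of_int k * x + y) / dimer_denom t x y)))"

definition dimer_Q :: "real \<Rightarrow> int \<Rightarrow> real" where
  "dimer_Q t k =
    (if even k
     then 0
     else 1 / (8 * pi\<^sup>2) * integral {- pi..pi} (\<lambda>x. integral {- pi..pi} (\<lambda>y.
            cos x * cos (of_int k * x) / dimer_denom t x y)))"

definition step :: "int \<Rightarrow> real" where
  "step k = (if k > 0 then 1 else 0)"

text \<open>
  The entry functions use the indices $1 \le j,k \le n$; \<open>Matrix.mat\<close> counts from 0.
\<close>

definition dimer_R_entry :: "real \<Rightarrow> int \<Rightarrow> int \<Rightarrow> complex" where
  "dimer_R_entry t j k = complex_of_real
     (2 * (- 1) powi \<lfloor>of_int (k - j) / (2 :: real)\<rfloor> * dimer_R t (k - j + 1)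
      + step (j - k) * t powi (j - k - 1))"

definition dimer_Q_entry :: "real \<Rightarrow> nat \<Rightarrow> int \<Rightarrow> int \<Rightarrow> complex" where
  "dimer_Q_entry t n j k = 2 * \<i> * complex_of_real
     ((- 1) powi \<lfloor>of_int (j + k) / (2 :: real)\<rfloor> * dimer_Q t (int n + 1 - j - k))"

definition dimer_R_block :: "real \<Rightarrow> nat \<Rightarrow> complex mat" where
  "dimer_R_block t n = Matrix.mat n n (\<lambda>(a, b). dimer_R_entry t (int a + 1) (int b + 1))"

definition dimer_Q_block :: "real \<Rightarrow> nat \<Rightarrow> complex mat" where
  "dimer_Q_block t n = Matrix.mat n n (\<lambda>(a, b). dimer_Q_entry t n (int a + 1) (int b + 1))"

definition dimer_matrix :: "real \<Rightarrow> nat \<Rightarrow> complex mat" where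
  "dimer_matrix t n = four_block_mat
     (dimer_R_block t n) (dimer_Q_block t n)
     (dimer_Q_block t n) (dimer_R_block t n)"

end

theory Submission
  imports Defs
begin

text \<open>
  With $A = \cos^2 x + (1+t^2)/2$ and $B = 1 + t^2 e^{2ix}$ the denominator is
  $A + \mathrm{Re}(B e^{2iy})/2$, and $A^2 - |B|^2/4 = S^2$ for $S = \sqrt{t^2+\cos^2x+\cos^4x}$. So the
  reciprocal is a multiple of a Poisson kernel in $e^{2iy}$, and the inner integrals are elementary.
  As $B = (1 - ite^{ix})(1 + ite^{ix})$, partial fractions write the $S$-dependent part of the result as
  $G(x) \pm G(x+\pi)$ with $G(x) = (\cos^2x - t\sin x)/((1-ite^{ix})S)$, and $G(x - \pi/2) = -e^{-ix}c(e^{ix})$.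
  The part without $S$ is a geometric series whose Fourier coefficients cancel the term
  $\theta(j-k)t^{j-k-1}$. Hence $\mathcal R = -T_n(c)$, and similarly $\mathcal Q_{jk} = \pm d_{j+k-n-1}$ with
  a sign depending only on $n$. A simultaneous permutation of rows and columns and a diagonal scaling
  by signs then carry $T_n(\phi)$ to $M_n$.
\<close>

subsection \<open>Trigonometric integrals over a full period\<close>

text \<open>Shifting moves the window to \<open>{a + c..a + p + c}\<close>. The piece beyond
  \<open>a + p\<close> is the missing piece \<open>{a..a + c}\<close> translated by one period; the
  bounds on \<open>c\<close> put the cut point \<open>a + p\<close> inside the window.\<close>

lemma integral_shift_periodic:
  fixes f :: "real \<Rightarrow> 'a :: euclidean_space"
  assumes cont: "continuous_on UNIV f" and per: "\<And>x. f (x + p) = f x"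
    and "0 \<le> c" "c \<le> p"
  shows "integral {a..a + p} (\<lambda>x. f (x + c)) = integral {a..a + p} f"
proof -
  have int: "f integrable_on {u..v}" for u v
    using cont continuous_on_subset integrable_continuous_real by blast
  have "integral {a..a + p} (\<lambda>x. f (x + c)) = integral {a + c..a + p + c} f"
    using integral_shift_real_ivl[of "a + c" c "a + p + c" f] by simp
  also have "\<dots> = integral {a + c..a + p} f + integral {a + p..a + p + c} f"
    by (rule Henstock_Kurzweil_Integration.integral_combine[symmetric]) (use assms int in auto)
  also have "integral {a + p..a + p + c} f = integral {a..a + c} f"
    using integral_shift_real_ivl[of "a + p" p "a + p + c" f] per by (simp add: algebra_simps)
  also have "integral {a + c..a + p} f + integral {a..a + c} f = integral {a..a + p} f"
    using Henstock_Kurzweil_Integration.integral_combine[of a "a + c" "a + p" f] assms int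
    by (simp add: add.commute)
  finally show ?thesis .
qed

lemma integral_period_shift:
  fixes f :: "real \<Rightarrow> 'a :: euclidean_space"
  assumes "continuous_on UNIV f" and "\<And>x. f (x + 2 * pi) = f x" and "\<bar>c\<bar> \<le> 2 * pi"
  shows "integral {- pi..pi} (\<lambda>x. f (x + c)) = integral {- pi..pi} f"
proof (cases "c \<ge> 0")
  case True
  then show ?thesis
    using integral_shift_periodic[of f "2 * pi" c "- pi"] assms by simp
next
  case False
  \<comment> \<open>Shifting \<open>\<lambda>x. f (x + c)\<close> by the positive amount
    \<open>- c\<close> restores \<open>f\<close>.\<close>
  have "integral {- pi..pi} (\<lambda>x. f (x + c + - c)) = integral {- pi..pi} (\<lambda>x. f (x + c))"
    using integral_shift_periodic[of "\<lambda>x. f (x + c)" "2 * pi" "- c" "- pi"] assms False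
    by (simp add: continuous_on_compose2[OF assms(1)] continuous_intros add.assoc add.commute add.left_commute)
      (smt (verit) continuous_on_compose2 assms continuous_on_add continuous_on_const continuous_on_id top_greatest)
  then show ?thesis by simp
qed

text \<open>Reconciles the interval of \<open>fourier_coeff\<close> with the symmetric one of the
  dimer integrals.\<close>

lemma integral_0_2pi_conv_symmetric:
  fixes f :: "real \<Rightarrow> 'a :: euclidean_space"
  assumes "continuous_on UNIV f" and "\<And>x. f (x + 2 * pi) = f x"
  shows "integral {0..2 * pi} f = integral {- pi..pi} f"
proof -
  have "integral {0..2 * pi} f = integral {- pi..pi} (\<lambda>x. f (x + pi))"
    using integral_shift_real_ivl[of 0 pi "2 * pi" f] by simp
  then show ?thesis
    using integral_period_shift[of f pi] assms by simp
qed

section \<open>Exponential integrals and the Poisson kernel\<close>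

lemma cis_add_2pi_multiple: "cis (of_int p * (x + 2 * pi)) = cis (of_int p * x)"
  using cis_multiple_2pi[of "of_int p"] by (simp add: distrib_left cis_mult[symmetric] mult_ac)

lemma integral_cis:
  "integral {- pi..pi} (\<lambda>x. cis (of_int p * x)) = (if p = 0 then 2 * of_real pi else 0)"
proof (cases "p = 0")
  case False
  let ?F = "\<lambda>x. cis (of_int p * x) / (\<i> * of_int p)"
  have "((\<lambda>x. cis (of_int p * x)) has_integral ?F pi - ?F (- pi)) {- pi..pi}"
  proof (rule fundamental_theorem_of_calculus)
    fix x :: real
    have "((\<lambda>z. exp (\<i> * of_int p * z) / (\<i> * of_int p)) has_field_derivative exp (\<i> * of_int p * of_real x))
        (at (of_real x))"
      using False by (auto intro!: derivative_eq_intros)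
    from has_vector_derivative_real_field[OF this]
    show "(?F has_vector_derivative cis (of_int p * x)) (at x within {- pi..pi})"
      by (simp add: cis_conv_exp mult.assoc has_vector_derivative_at_within)
  qed simp
  \<comment> \<open>The antiderivative has period \<open>2 * pi\<close> because \<open>p\<close> is
    an integer, so its endpoint values cancel.\<close>
  moreover have "?F pi = ?F (- pi)"
    using cis_add_2pi_multiple[of p "- pi"] by simp
  ultimately show ?thesis
    using False by (simp add: integral_unique)
qed (simp add: scaleR_conv_of_real)

text \<open>Formally, the geometric series in \<open>q * cis (2 * y)\<close> is expanded and its
  term of total frequency zero is kept. The proof exchanges no sum and integral: a recursion linking
  \<open>p\<close> with \<open>p + 2\<close> determines all values once those for positive
  \<open>p\<close> are known to vanish.\<close>

lemma integral_cis_geometric: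
  fixes q :: complex and p :: int
  assumes q: "cmod q < 1"
  shows "integral {- pi..pi} (\<lambda>y. cis (of_int p * y) / (1 - q * cis (2 * y)))
       = (if even p \<and> p \<le> 0 then 2 * of_real pi * q ^ nat (- p div 2) else 0)"
proof -
  define I where "I p = integral {- pi..pi} (\<lambda>y. cis (of_int p * y) / (1 - q * cis (2 * y)))" for p :: int
  have nz: "1 - cmod q \<le> cmod (1 - q * cis (2 * y))" for y
    by (metis mult.right_neutral norm_cis norm_mult norm_one norm_triangle_ineq2)
  have nz': "1 - q * cis (2 * y) \<noteq> 0" for y
    using nz[of y] q by auto
  have int: "(\<lambda>y. cis (of_int p * y) / (1 - q * cis (2 * y))) integrable_on {- pi..pi}" for p
    by (intro integrable_continuous_real continuous_intros) (use nz' in auto)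
  \<comment> \<open>Subtracting \<open>q\<close> times the integrand for \<open>p + 2\<close>
    cancels the denominator; a source term remains at \<open>p = 0\<close> only.\<close>
  have rec: "I p = q * I (p + 2) + (if p = 0 then 2 * of_real pi else 0)" for p
  proof -
    have "cis (of_int p * y) / (1 - q * cis (2 * y))
        - q * (cis (of_int (p + 2) * y) / (1 - q * cis (2 * y))) = cis (of_int p * y)" for y
    proof -
      have "cis (of_int (p + 2) * y) = cis (of_int p * y) * cis (2 * y)"
        by (simp add: cis_mult algebra_simps)
      then show ?thesis using nz'[of y] by (simp add: divide_simps) (simp add: algebra_simps)
    qed
    then have "I p - q * I (p + 2) = integral {- pi..pi} (\<lambda>y. cis (of_int p * y))"
      unfolding I_def Henstock_Kurzweil_Integration.integral_mult_right[symmetric]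
      by (subst Henstock_Kurzweil_Integration.integral_diff[symmetric])
        (auto intro!: int integrable_on_mult_right simp del: of_int_add times_divide_eq_right)
    then show ?thesis unfolding integral_cis by (simp only: diff_eq_eq add.commute)
  qed
  have bound: "cmod (I p) \<le> 1 / (1 - cmod q) * (2 * pi)" for p
  proof -
    have "cmod (cis (of_int p * y) / (1 - q * cis (2 * y))) \<le> 1 / (1 - cmod q)" for y
      using nz[of y] q by (simp add: norm_divide frac_le)
    moreover have "continuous_on {- pi..pi} (\<lambda>y. cis (of_int p * y) / (1 - q * cis (2 * y)))"
      by (intro continuous_intros) (use nz' in auto)
    ultimately show ?thesis
      unfolding I_def using integral_bound[of "- pi" pi "\<lambda>y. cis (of_int p * y) / (1 - q * cis (2 * y))"]
      by fastforce
  qed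
  \<comment> \<open>For positive \<open>p\<close> the recursion moves away from the source at zero,
    so it stays homogeneous.\<close>
  have iter: "I p = q ^ m * I (p + 2 * int m)" if "p > 0" for p m
  proof (induction m)
    case (Suc m)
    then show ?case using rec[of "p + 2 * int m"] that by (simp add: algebra_simps)
  qed simp
  \<comment> \<open>The bound does not depend on the frequency, so the factor \<open>q ^ m\<close>
    forces the value to zero.\<close>
  have pos: "I p = 0" if "p > 0" for p
  proof -
    have "(\<lambda>m. cmod q ^ m * (1 / (1 - cmod q) * (2 * pi))) \<longlonglongrightarrow> 0 * (1 / (1 - cmod q) * (2 * pi))"
      using q by (intro tendsto_intros LIMSEQ_power_zero) auto
    moreover have "cmod (I p) \<le> cmod q ^ m * (1 / (1 - cmod q) * (2 * pi))" for m
      using iter[OF that, of m] bound by (metis mult_left_mono norm_ge_zero norm_mult norm_power zero_le_power)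
    ultimately have "cmod (I p) \<le> 0"
      by (intro LIMSEQ_le_const) auto
    then show ?thesis by simp
  qed
  \<comment> \<open>Going down from frequency 2, the source at zero enters once and each further
    step contributes a factor \<open>q\<close>.\<close>
  have even: "I (- 2 * int m) = 2 * of_real pi * q ^ m" for m
  proof (induction m)
    case 0
    then show ?case using rec[of 0] pos[of 2] by simp
  next
    case (Suc m)
    then show ?case using rec[of "- 2 * int (Suc m)"] by (simp add: algebra_simps)
  qed
  \<comment> \<open>Odd frequencies skip the source, so the vanishing at frequency 1 propagates
    downwards.\<close>
  have odd: "I (1 - 2 * int m) = 0" for m
  proof (induction m)
    case 0
    then show ?case using pos[of 1] by simp
  next
    case (Suc m)
    then show ?case using rec[of "1 - 2 * int (Suc m)"]
      by (simp add: algebra_simps split: if_splits)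
  qed
  consider "p > 0" | "p \<le> 0" "even p" | "p \<le> 0" "odd p" by linarith
  then have "I p = (if even p \<and> p \<le> 0 then 2 * of_real pi * q ^ nat (- p div 2) else 0)"
  proof cases
    case 2
    then have "p = - 2 * int (nat (- p div 2))" by auto
    then show ?thesis using even[of "nat (- p div 2)"] 2 by simp
  next
    case 3
    then have "p = 1 - 2 * int (nat ((1 - p) div 2))" by auto
    then show ?thesis using odd[of "nat ((1 - p) div 2)"] 3 by simp
  qed (use pos in auto)
  then show ?thesis unfolding I_def .
qed

text \<open>With z = q e^{2iy} and D the denominator, the choice of \<open>q\<close> gives |1 - z|^2
  = 2 D / (A + S) and 1 - |z|^2 = 2 S / (A + S), so S / D is a Poisson kernel. Splitting it into a
  Cauchy kernel, its conjugate and a constant leaves integrals that are already known.\<close>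

lemma integral_cis_over_trig:
  fixes A S :: real and B :: complex and p :: int
  assumes A: "A > 0" and S: "S > 0" and AS: "(cmod B)\<^sup>2 = 4 * (A\<^sup>2 - S\<^sup>2)"
  defines "q \<equiv> - B / of_real (2 * (A + S))"
  shows "cmod q < 1"
    and "A + Re (B * cis (2 * y)) / 2 > 0"
    and "integral {- pi..pi} (\<lambda>y. cis (of_int p * y) / of_real (A + Re (B * cis (2 * y)) / 2))
       = (integral {- pi..pi} (\<lambda>y. cis (of_int p * y) / (1 - q * cis (2 * y)))
          + cnj (integral {- pi..pi} (\<lambda>y. cis (of_int (- p) * y) / (1 - q * cis (2 * y))))
          - integral {- pi..pi} (\<lambda>y. cis (of_int p * y))) / of_real S"
proof -
  have "(cmod B)\<^sup>2 < (2 * A)\<^sup>2" using AS S by (simp add: power2_eq_square)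
  then have B: "cmod B < 2 * A" by (rule power2_less_imp_less) (use A in simp)
  show q: "cmod q < 1"
    using A S B by (simp add: q_def norm_divide del: of_real_add of_real_mult)
  show pos: "A + Re (B * cis (2 * y)) / 2 > 0" for y
    using B abs_Re_le_cmod[of "B * cis (2 * y)"] unfolding norm_mult norm_cis by linarith
  have nz: "1 - q * cis (2 * y) \<noteq> 0" for y
  proof
    assume "1 - q * cis (2 * y) = 0"
    then have "q * cis (2 * y) = 1" by simp
    then have "cmod (q * cis (2 * y)) = 1" by (metis norm_one)
    with q show False by (simp add: norm_mult)
  qed
  let ?F = "\<lambda>p y. cis (of_int p * y) / (1 - q * cis (2 * y))"
  have int: "?F p integrable_on {- pi..pi}" for p
    by (intro integrable_continuous_real continuous_intros) (use nz in auto)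
  have pt: "cis (of_int p * y) / of_real (A + Re (B * cis (2 * y)) / 2)
      = (?F p y + cnj (?F (- p) y) - cis (of_int p * y)) / of_real S" for y
  proof -
    define z where "z = q * cis (2 * y)"
    define D where "D = A + Re (B * cis (2 * y)) / 2"
    have z1: "z \<noteq> 1" "cnj z \<noteq> 1" using nz[of y] complex_cnj_one_iff[of z] by (auto simp: z_def)
    have "(cmod z)\<^sup>2 = (cmod B)\<^sup>2 / (4 * (A + S)\<^sup>2)"
      by (simp add: z_def q_def norm_mult norm_divide power_divide power_mult_distrib del: of_real_add of_real_mult)
        (simp add: power2_eq_square algebra_simps)
    also have "\<dots> = (A - S) / (A + S)"
    proof -
      have "A + S \<noteq> 0" using A S by simp
      then show ?thesis unfolding AS unfolding power2_eq_square square_diff_square_factored by simp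
    qed
    finally have zz: "(cmod z)\<^sup>2 = (A - S) / (A + S)" .
    have Rez: "Re z = - Re (B * cis (2 * y)) / (2 * (A + S))"
    proof -
      have "z = - (B * cis (2 * y)) / of_real (2 * (A + S))" by (simp add: z_def q_def)
      then show ?thesis by (simp only: Re_divide_of_real uminus_complex.sel)
    qed
    have 1: "(1 - z) * (1 - cnj z) = of_real (1 - 2 * Re z + (cmod z)\<^sup>2)"
    proof -
      have "(1 - z) * (1 - cnj z) = 1 - (z + cnj z) + z * cnj z"
        by (simp add: algebra_simps)
      then show ?thesis by (simp only: complex_add_cnj complex_norm_square of_real_add of_real_diff of_real_1)
    qed
    have 2: "1 - 2 * Re z + (cmod z)\<^sup>2 = 2 * D / (A + S)"
    proof -
      have "A + S \<noteq> 0" using A S by simp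
      moreover have "1 - 2 * (- r / (2 * m)) + (A - S) / m = 2 * (A + r / 2) / m"
        if "m \<noteq> 0" "m = A + S" for r m
        using that(1) by (simp add: field_simps) (simp add: that(2) algebra_simps)
      ultimately show ?thesis unfolding zz Rez D_def by blast
    qed
    have "1 - (cmod z)\<^sup>2 = 2 * S / (A + S)"
      using A S by (simp add: zz field_simps)
    moreover have "1 - z * cnj z = of_real (1 - (cmod z)\<^sup>2)"
      by (simp only: of_real_diff of_real_1 complex_norm_square)
    ultimately have 3: "1 - z * cnj z = of_real (2 * S / (A + S))" by simp
    \<comment> \<open>The Poisson kernel as the sum of two conjugate Cauchy kernels minus
      one.\<close>
    have "1 / (1 - z) + cnj (1 / (1 - z)) - 1 = (1 - z * cnj z) / ((1 - z) * (1 - cnj z))"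
    proof -
      have "1 / u + 1 / v - 1 = (u + v - u * v) / (u * v)" if "u \<noteq> 0" "v \<noteq> 0" for u v :: complex
        using that by (simp add: divide_simps)
      from this[of "1 - z" "1 - cnj z"] z1 show ?thesis by (simp add: algebra_simps)
    qed
    also have "\<dots> = of_real (S / D)"
    proof -
      have "2 * S / m / (2 * D / m) = S / D" if "m > 0" for m :: real
        using that by simp
      from this[of "A + S"] show ?thesis
        unfolding 1 2 3 of_real_divide[symmetric] using A S by simp
    qed
    finally have "(1 / (1 - z) + cnj (1 / (1 - z)) - 1) / of_real S = 1 / of_real D"
      using S by simp
    then have "cis (of_int p * y) / of_real D
       = cis (of_int p * y) * ((1 / (1 - z) + cnj (1 / (1 - z)) - 1) / of_real S)" by simp
    \<comment> \<open>The conjugated kernel is paired with frequency \<open>- p\<close>, since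
      conjugating the whole product restores \<open>p\<close>.\<close>
    moreover have "cnj (cis (of_int (- p) * y)) = cis (of_int p * y)" by (simp add: cis_cnj)
    ultimately show ?thesis
      unfolding D_def[symmetric] by (simp add: z_def[symmetric] right_diff_distrib distrib_left)
  qed
  have "((\<lambda>y. cnj (?F (- p) y)) has_integral cnj (integral {- pi..pi} (?F (- p)))) {- pi..pi}"
    using int[of "- p"] has_integral_cnj[of "?F (- p)" _ "{- pi..pi}"] by (simp only: o_def integrable_integral)
  moreover have "(\<lambda>y. cis (of_int p * y)) integrable_on {- pi..pi}"
    by (intro integrable_continuous_real continuous_intros)
  ultimately have "((\<lambda>y. (?F p y + cnj (?F (- p) y) - cis (of_int p * y)) / of_real S) has_integral
     (integral {- pi..pi} (?F p) + cnj (integral {- pi..pi} (?F (- p)))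
       - integral {- pi..pi} (\<lambda>y. cis (of_int p * y))) / of_real S) {- pi..pi}"
    by (intro has_integral_divide has_integral_diff has_integral_add integrable_integral int)
  then show "integral {- pi..pi} (\<lambda>y. cis (of_int p * y) / of_real (A + Re (B * cis (2 * y)) / 2))
       = (integral {- pi..pi} (?F p) + cnj (integral {- pi..pi} (?F (- p)))
          - integral {- pi..pi} (\<lambda>y. cis (of_int p * y))) / of_real S"
    unfolding pt by (rule integral_unique)
qed

text \<open>Frequencies 0 and 2 suffice because the dimer numerators have the form
  \<open>Re (a * cis (2 * y) + b)\<close>. At frequency 2 only the conjugate kernel contributes, and
  the hypothesis on the norm of \<open>B\<close> rewrites its coefficient with denominator
  \<open>B\<close>, which factors in the dimer case.\<close>

lemma integral_inverse_trig:
  fixes A S :: real and B :: complex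
  assumes "A > 0" and "S > 0" and "(cmod B)\<^sup>2 = 4 * (A\<^sup>2 - S\<^sup>2)"
  shows "integral {- pi..pi} (\<lambda>y. 1 / complex_of_real (A + Re (B * cis (2 * y)) / 2)) = of_real (2 * pi / S)"
    and "B \<noteq> 0 \<Longrightarrow> integral {- pi..pi} (\<lambda>y. cis (2 * y) / complex_of_real (A + Re (B * cis (2 * y)) / 2))
       = of_real (4 * pi * (S - A)) / (B * of_real S)"
proof -
  note * = integral_cis_over_trig[OF assms]
  note geo = integral_cis_geometric[OF *(1)]
  show "integral {- pi..pi} (\<lambda>y. 1 / complex_of_real (A + Re (B * cis (2 * y)) / 2)) = of_real (2 * pi / S)"
    using *(3)[of 0] geo[of 0] by (simp add: scaleR_conv_of_real)
  assume "B \<noteq> 0"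
  have "B * cnj B = of_real (4 * (A\<^sup>2 - S\<^sup>2))"
    by (simp only: complex_norm_square[symmetric] assms flip: of_real_power)
  also have "\<dots> = of_real (4 * (A - S)) * of_real (A + S)"
    by (simp add: power2_eq_square algebra_simps)
  finally have BB: "cnj B = of_real (4 * (A - S)) * of_real (A + S) / B"
    using \<open>B \<noteq> 0\<close> by (simp add: field_simps)
  have "complex_of_real (A + S) \<noteq> 0" using assms by (simp del: of_real_add)
  have q: "cnj (- B / of_real (2 * (A + S))) = of_real (2 * (S - A)) / B"
  proof -
    have "- (of_real (4 * (A - S)) * Y / B) / (2 * Y) = of_real (2 * (S - A)) / B"
      if "Y \<noteq> 0" for Y :: complex
      using that \<open>B \<noteq> 0\<close> by (simp add: field_simps)
    with \<open>complex_of_real (A + S) \<noteq> 0\<close> show ?thesis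
      by (simp only: complex_cnj_divide complex_cnj_minus complex_cnj_mult complex_cnj_numeral BB complex_cnj_complex_of_real of_real_mult of_real_numeral)
  qed
  have "integral {- pi..pi} (\<lambda>y. cis (2 * y) / complex_of_real (A + Re (B * cis (2 * y)) / 2))
      = (0 + cnj (2 * of_real pi * (- B / of_real (2 * (A + S)))) - 0) / of_real S"
    using *(3)[of 2] unfolding geo integral_cis by simp
  also have "\<dots> = of_real (4 * pi * (S - A)) / (B * of_real S)"
    unfolding complex_cnj_mult q by simp
  finally show "integral {- pi..pi} (\<lambda>y. cis (2 * y) / complex_of_real (A + Re (B * cis (2 * y)) / 2))
       = of_real (4 * pi * (S - A)) / (B * of_real S)" .
qed

subsection \<open>The integral over \<open>y\<close>\<close>

definition dimer_S :: "real \<Rightarrow> real \<Rightarrow> real" where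
  "dimer_S t x = sqrt (t\<^sup>2 + (cos x)\<^sup>2 + (cos x) ^ 4)"

definition dimer_A :: "real \<Rightarrow> real \<Rightarrow> real" where
  "dimer_A t x = (cos x)\<^sup>2 + (1 + t\<^sup>2) / 2"

definition dimer_B :: "real \<Rightarrow> real \<Rightarrow> complex" where
  "dimer_B t x = 1 + of_real (t\<^sup>2) * cis (2 * x)"

definition dimer_G :: "real \<Rightarrow> real \<Rightarrow> complex" where
  "dimer_G t x = of_real ((cos x)\<^sup>2 - t * sin x) / ((1 - \<i> * of_real t * cis x) * of_real (dimer_S t x))"

text \<open>Double angle formulas collect all dependence on \<open>y\<close> into the single
  frequency 2, the shape required by \<open>integral_inverse_trig\<close>.\<close>

lemma dimer_denom_eq: "dimer_denom t x y = dimer_A t x + Re (dimer_B t x * cis (2 * y)) / 2"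
proof -
  have "Re (dimer_B t x * cis (2 * y)) = cos (2 * y) + t\<^sup>2 * cos (2 * (x + y))"
    by (simp add: dimer_B_def distrib_left cos_add algebra_simps del: of_real_power)
  then show ?thesis
    unfolding dimer_denom_def dimer_A_def cos_double_cos by (simp add: field_simps)
qed

lemma dimer_S_sq: "(dimer_S t x)\<^sup>2 = t\<^sup>2 + (cos x)\<^sup>2 + (cos x) ^ 4"
  by (simp add: dimer_S_def)

context
  fixes t :: real
  assumes t: "0 < t" "t < 1"
begin

lemma dimer_S_pos: "dimer_S t x > 0"
  using t by (simp add: dimer_S_def add_pos_nonneg)

lemma dimer_A_pos: "dimer_A t x > 0"
  unfolding dimer_A_def by (intro add_nonneg_pos divide_pos_pos add_pos_nonneg) auto

lemma one_minus_small_cis_nonzero: "1 - \<i> * of_real t * cis x \<noteq> 0" "1 + \<i> * of_real t * cis x \<noteq> 0"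
proof -
  have "cmod (\<i> * of_real t * cis x) < 1" using t by (simp add: norm_mult)
  then have "\<i> * of_real t * cis x \<noteq> 1" "\<i> * of_real t * cis x \<noteq> - 1" by auto
  then show "1 - \<i> * of_real t * cis x \<noteq> 0" "1 + \<i> * of_real t * cis x \<noteq> 0"
    by (metis eq_iff_diff_eq_0, metis add.commute eq_neg_iff_add_eq_0)
qed

lemma dimer_B_factor: "dimer_B t x = (1 - \<i> * of_real t * cis x) * (1 + \<i> * of_real t * cis x)"
proof -
  have "cis (2 * x) = cis x * cis x" by (simp add: cis_mult)
  then show ?thesis by (simp add: dimer_B_def algebra_simps power2_eq_square)
qed

lemma dimer_B_nonzero: "dimer_B t x \<noteq> 0"
  using one_minus_small_cis_nonzero by (simp add: dimer_B_factor)

text \<open>The condition linking \<open>A\<close>, \<open>B\<close> and \<open>S\<close> in the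
  Poisson kernel lemmas; both sides equal 1 + 2 t^2 cos(2x) + t^4. It explains the radicand of
  \<open>dimer_S\<close>.\<close>

lemma norm_dimer_B: "(cmod (dimer_B t x))\<^sup>2 = 4 * ((dimer_A t x)\<^sup>2 - (dimer_S t x)\<^sup>2)"
proof -
  have 1: "(cmod (dimer_B t x))\<^sup>2 = (1 + t\<^sup>2 * cos (2 * x))\<^sup>2 + (t\<^sup>2 * sin (2 * x))\<^sup>2"
    by (simp add: cmod_power2 dimer_B_def del: of_real_power)
  have 2: "cos (2 * x) = 2 * (cos x)\<^sup>2 - 1" by (rule cos_double_cos)
  have 3: "(sin (2 * x))\<^sup>2 = 1 - (cos (2 * x))\<^sup>2" by (simp add: sin_squared_eq)
  show ?thesis
    unfolding 1 dimer_S_sq power_mult_distrib 3 unfolding 2 dimer_A_def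
    by (simp add: field_simps power2_eq_square power4_eq_xxxx)
qed

lemma dimer_denom_pos: "dimer_denom t x y > 0"
  unfolding dimer_denom_eq
  by (rule integral_cis_over_trig(2)[OF dimer_A_pos dimer_S_pos norm_dimer_B])

text \<open>A combination of the moments of frequency 0 and 2; the denominator is real, so the real
  part can be taken at the end. The summand \<open>2 * a / dimer_B t x\<close> is kept apart because
  it lacks \<open>dimer_S\<close> and later cancels the \<open>step\<close> term of the
  entries.\<close>

lemma dimer_inner_integral:
  "integral {- pi..pi} (\<lambda>y. Re (a * cis (2 * y) + b) / dimer_denom t x y)
   = 2 * pi * Re (2 * a / dimer_B t x
       + (b * dimer_B t x - 2 * a * of_real (dimer_A t x)) / (dimer_B t x * of_real (dimer_S t x)))"
proof -
  let ?D = "\<lambda>y. complex_of_real (dimer_denom t x y)"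
  have nz: "?D y \<noteq> 0" for y using dimer_denom_pos[of x y] by simp
  note J = integral_inverse_trig[OF dimer_A_pos dimer_S_pos norm_dimer_B, of x, folded dimer_denom_eq]
  have contD: "continuous_on UNIV ?D"
    unfolding dimer_denom_def by (intro continuous_intros)
  have i0: "(\<lambda>y. 1 / ?D y) integrable_on {- pi..pi}"
    and i2: "(\<lambda>y. cis (2 * y) / ?D y) integrable_on {- pi..pi}"
    by (intro integrable_continuous_real continuous_intros continuous_on_subset[OF contD] ballI nz; simp)+
  have "((\<lambda>y. a * (cis (2 * y) / ?D y) + b * (1 / ?D y)) has_integral
     a * (of_real (4 * pi * (dimer_S t x - dimer_A t x)) / (dimer_B t x * of_real (dimer_S t x)))
       + b * of_real (2 * pi / dimer_S t x)) {- pi..pi}"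
    using i0 i2 J dimer_B_nonzero
    by (intro has_integral_add has_integral_mult_right) (auto simp: has_integral_iff)
  then have "((\<lambda>y. (a * cis (2 * y) + b) / ?D y) has_integral
     of_real (2 * pi) * (2 * a / dimer_B t x
       + (b * dimer_B t x - 2 * a * of_real (dimer_A t x)) / (dimer_B t x * of_real (dimer_S t x)))) {- pi..pi}"
  proof (rule has_integral_eq_rhs[OF has_integral_eq, rotated])
    show "of_real (2 * pi) * (2 * a / dimer_B t x
       + (b * dimer_B t x - 2 * a * of_real (dimer_A t x)) / (dimer_B t x * of_real (dimer_S t x)))
       = a * (of_real (4 * pi * (dimer_S t x - dimer_A t x)) / (dimer_B t x * of_real (dimer_S t x)))
       + b * of_real (2 * pi / dimer_S t x)"
      using dimer_B_nonzero[of x] dimer_S_pos[of x] by (simp add: field_simps)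
  qed (simp add: add_divide_distrib)
  from has_integral_linear[OF this bounded_linear_Re]
  have "((\<lambda>y. Re (a * cis (2 * y) + b) / dimer_denom t x y) has_integral
     Re (of_real (2 * pi) * (2 * a / dimer_B t x
       + (b * dimer_B t x - 2 * a * of_real (dimer_A t x)) / (dimer_B t x * of_real (dimer_S t x))))) {- pi..pi}"
    by (simp only: o_def Re_divide_of_real)
  then show ?thesis
    by (simp only: integral_unique Re_complex_of_real times_complex.sel Im_complex_of_real mult_zero_left diff_zero)
qed

lemma dimer_G_shift_pi:
  "dimer_G t (x + pi) = of_real ((cos x)\<^sup>2 + t * sin x) / ((1 + \<i> * of_real t * cis x) * of_real (dimer_S t x))"
proof -
  have "cis (x + pi) = - cis x" by (simp add: cis_mult[symmetric])
  moreover have "dimer_S t (x + pi) = dimer_S t x" by (simp add: dimer_S_def)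
  ultimately show ?thesis by (simp add: dimer_G_def)
qed

text \<open>The two factors of \<open>dimer_B\<close> occur as the denominators of the two
  \<open>dimer_G\<close> terms, so both claims compare numerators over a common denominator, modulo
  cos^2 + sin^2 = 1. The sum serves even \<open>k\<close>, the difference odd
  \<open>k\<close>.\<close>

lemma dimer_G_partial_fractions:
  shows "(dimer_B t x - 2 * of_real (dimer_A t x)) / (dimer_B t x * of_real (dimer_S t x))
      = - (dimer_G t x + dimer_G t (x + pi))"
    and "of_real t * (cis (- x) * dimer_B t x - 2 * cis x * of_real (dimer_A t x)) / (dimer_B t x * of_real (dimer_S t x))
      = \<i> * (dimer_G t x - dimer_G t (x + pi))"
proof -
  define u v where "u = 1 - \<i> * of_real t * cis x" and "v = 1 + \<i> * of_real t * cis x"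
  have nz: "u \<noteq> 0" "v \<noteq> 0" "complex_of_real (dimer_S t x) \<noteq> 0"
    using one_minus_small_cis_nonzero[of x] dimer_S_pos[of x] by (auto simp: u_def v_def)
  define c s where "c = complex_of_real (cos x)" and "s = complex_of_real (sin x)"
  have cs: "c\<^sup>2 + s\<^sup>2 = 1" unfolding c_def s_def by (simp flip: of_real_power of_real_add)
  have e: "cis x = c + \<i> * s" "cis (- x) = c - \<i> * s" by (auto simp: complex_eq_iff c_def s_def)
  have A: "2 * complex_of_real (dimer_A t x) = 2 * c\<^sup>2 + 1 + (of_real t)\<^sup>2"
    by (simp add: dimer_A_def c_def)
  have A': "2 * cis x * complex_of_real (dimer_A t x) = cis x * (2 * c\<^sup>2 + 1 + (of_real t)\<^sup>2)"
    unfolding A[symmetric] by simp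
  \<comment> \<open>Here \<open>j\<close> is an abstract square root of -1, so that both relations
    can act as rewrite rules for products. Their nested forms reach factors inside right-associated
    monomials.\<close>
  have alg: "(1 - j * r * (c + j * s)) * (1 + j * r * (c + j * s)) - (2 * c\<^sup>2 + 1 + r\<^sup>2)
      = - ((c\<^sup>2 - r * s) * (1 + j * r * (c + j * s)) + (c\<^sup>2 + r * s) * (1 - j * r * (c + j * s)))"
    "r * ((c - j * s) * ((1 - j * r * (c + j * s)) * (1 + j * r * (c + j * s))) - (c + j * s) * (2 * c\<^sup>2 + 1 + r\<^sup>2))
      = j * ((c\<^sup>2 - r * s) * (1 + j * r * (c + j * s)) - (c\<^sup>2 + r * s) * (1 - j * r * (c + j * s)))"
    if "c\<^sup>2 + s\<^sup>2 = 1" "j * j = - 1" for j r c s :: complex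
  proof -
    have j: "j * j = - 1" "j * (j * x) = - x" for x
      using that(2) by (simp_all add: mult.assoc[symmetric])
    have c1: "c * c = 1 - s * s"
      using that(1) by (simp add: power2_eq_square eq_diff_eq)
    have "c * (c * x) = (c * c) * x" for x by (simp only: mult.assoc)
    then have c: "c * c = 1 - s * s" "c * (c * x) = x - s * (s * x)" for x
      using c1 by (simp_all add: left_diff_distrib mult.assoc)
    show "(1 - j * r * (c + j * s)) * (1 + j * r * (c + j * s)) - (2 * c\<^sup>2 + 1 + r\<^sup>2)
      = - ((c\<^sup>2 - r * s) * (1 + j * r * (c + j * s)) + (c\<^sup>2 + r * s) * (1 - j * r * (c + j * s)))"
      "r * ((c - j * s) * ((1 - j * r * (c + j * s)) * (1 + j * r * (c + j * s))) - (c + j * s) * (2 * c\<^sup>2 + 1 + r\<^sup>2))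
      = j * ((c\<^sup>2 - r * s) * (1 + j * r * (c + j * s)) - (c\<^sup>2 + r * s) * (1 - j * r * (c + j * s)))"
      by (simp_all add: power2_eq_square algebra_simps j c)
  qed
  have 1: "u * v - 2 * of_real (dimer_A t x) = - ((c\<^sup>2 - of_real t * s) * v + (c\<^sup>2 + of_real t * s) * u)"
    unfolding A u_def v_def e using alg(1)[OF cs i_squared] .
  have 2: "of_real t * (cis (- x) * (u * v) - 2 * cis x * of_real (dimer_A t x))
      = \<i> * ((c\<^sup>2 - of_real t * s) * v - (c\<^sup>2 + of_real t * s) * u)"
    unfolding A'[unfolded e] u_def v_def e using alg(2)[OF cs i_squared] .
  have G: "dimer_G t x = (c\<^sup>2 - of_real t * s) / (u * of_real (dimer_S t x))"
    "dimer_G t (x + pi) = (c\<^sup>2 + of_real t * s) / (v * of_real (dimer_S t x))"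
    unfolding dimer_G_shift_pi by (simp_all add: dimer_G_def c_def s_def u_def v_def)
  have B: "dimer_B t x = u * v" by (simp add: dimer_B_factor u_def v_def)
  show "(dimer_B t x - 2 * of_real (dimer_A t x)) / (dimer_B t x * of_real (dimer_S t x))
      = - (dimer_G t x + dimer_G t (x + pi))"
    unfolding B 1 G using nz by (simp add: divide_simps; simp add: algebra_simps)
  show "of_real t * (cis (- x) * dimer_B t x - 2 * cis x * of_real (dimer_A t x)) / (dimer_B t x * of_real (dimer_S t x))
      = \<i> * (dimer_G t x - dimer_G t (x + pi))"
    unfolding B 2 G using nz by (simp add: divide_simps; simp add: algebra_simps)
qed

end

subsection \<open>Fourier coefficients of the symbol\<close>

definition dimer_c :: "real \<Rightarrow> real \<Rightarrow> complex" where
  "dimer_c t x = of_real (t * cos x + (sin x)\<^sup>2)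
     / ((of_real t - cis (- x)) * of_real (sqrt (t\<^sup>2 + (sin x)\<^sup>2 + (sin x) ^ 4)))"

definition dimer_d :: "real \<Rightarrow> real \<Rightarrow> real" where
  "dimer_d t x = sin x / sqrt (t\<^sup>2 + (sin x)\<^sup>2 + (sin x) ^ 4)"

definition dimer_c_coeff :: "real \<Rightarrow> int \<Rightarrow> complex" where
  "dimer_c_coeff t m = 1 / (2 * of_real pi) * integral {- pi..pi} (\<lambda>x. dimer_c t x * cis (- (of_int m * x)))"

definition dimer_d_coeff :: "real \<Rightarrow> int \<Rightarrow> complex" where
  "dimer_d_coeff t m = 1 / (2 * of_real pi) * integral {- pi..pi} (\<lambda>x. of_real (dimer_d t x) * cis (- (of_int m * x)))"

lemma cis_int_pi: "cis (of_int l * pi) = (if even l then 1 else - 1)"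
  using cis_power_int[of pi l] by (simp add: power_int_minus_left split: if_splits)

lemma cis_plus_2pi [simp]: "cis (x + 2 * pi) = cis x"
  using cis_add_2pi_multiple[of 1 x] by simp

lemma cis_int_shift_pi: "cis (of_int k * (x + pi)) = (if even k then 1 else - 1) * cis (of_int k * x)"
  by (simp add: distrib_left cis_mult[symmetric] cis_int_pi)

text \<open>Brings the numerator for even \<open>k\<close> into the form expected by
  \<open>dimer_inner_integral\<close>, with both coefficients equal to
  \<open>cis u / 2\<close>.\<close>

lemma cos_mult_cos_add_double: "cos y * cos (u + y) = Re (cis u / 2 * cis (2 * y) + cis u / 2)"
  by (simp add: cis_mult cos_times_cos add.commute flip: Re_divide_numeral add_divide_distrib;
    simp add: cos_times_cos algebra_simps flip: mult_2)

section \<open>Reduction of the double integrals for R to single integrals\<close>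

context
  fixes t :: real
  assumes t: "0 < t" "t < 1"
begin

lemma continuous_dimer_G: "continuous_on UNIV (dimer_G t)"
proof -
  have "(1 - \<i> * of_real t * cis x) * of_real (sqrt (t\<^sup>2 + (cos x)\<^sup>2 + (cos x) ^ 4)) \<noteq> 0" for x
    using one_minus_small_cis_nonzero[OF t, of x] dimer_S_pos[OF t, of x] by (simp add: dimer_S_def)
  then show ?thesis
    unfolding dimer_G_def dimer_S_def by (intro continuous_intros) auto
qed

lemma dimer_G_2pi: "dimer_G t (x + 2 * pi) = dimer_G t x"
  by (simp add: dimer_G_def dimer_S_def)

text \<open>The sign between \<open>dimer_G t x\<close> and \<open>dimer_G t (x + pi)\<close> is the
  value of \<open>cis (of_int k * pi)\<close>. Hence the second term, with its exponential, is the
  first one translated by \<open>pi\<close>, and by periodicity both contribute equally.\<close>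

lemma dimer_R_eq:
  "dimer_R t k = (if even k
     then Re (integral {- pi..pi} (\<lambda>x. cis (of_int k * x) / dimer_B t x)
              - integral {- pi..pi} (\<lambda>x. cis (of_int k * x) * dimer_G t x)) / (4 * pi)
     else Re (of_real t * integral {- pi..pi} (\<lambda>x. cis (of_int (k + 1) * x) / dimer_B t x)
              + \<i> * integral {- pi..pi} (\<lambda>x. cis (of_int k * x) * dimer_G t x)) / (4 * pi))"
proof -
  define H where "H x = cis (of_int k * x) * dimer_G t x" for x
  define K where "K = integral {- pi..pi} H"
  define geo where "geo l = integral {- pi..pi} (\<lambda>x. cis (of_int l * x) / dimer_B t x)" for l :: int
  have contH: "continuous_on UNIV H"
    unfolding H_def by (intro continuous_intros continuous_dimer_G)
  have intH: "(H has_integral K) {- pi..pi}"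
    unfolding K_def using contH continuous_on_subset by (blast intro: integrable_integral integrable_continuous_real)
  have "continuous_on UNIV (\<lambda>x. H (x + pi))"
    by (intro continuous_on_compose2[OF contH] continuous_intros) auto
  then have "(\<lambda>x. H (x + pi)) integrable_on {- pi..pi}"
    using continuous_on_subset by (blast intro: integrable_continuous_real)
  moreover have "integral {- pi..pi} (\<lambda>x. H (x + pi)) = K"
    unfolding K_def using contH
    by (rule integral_period_shift) (simp_all add: H_def dimer_G_2pi cis_add_2pi_multiple)
  ultimately have intH': "((\<lambda>x. H (x + pi)) has_integral K) {- pi..pi}"
    by (simp add: has_integral_iff)
  have intB: "((\<lambda>x. cis (of_int l * x) / dimer_B t x) has_integral geo l) {- pi..pi}" for l
    unfolding geo_def
    by (intro integrable_integral integrable_continuous_real continuous_intros)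
      (auto simp: dimer_B_def[abs_def] dimer_B_nonzero[OF t, unfolded dimer_B_def of_real_power] intro!: continuous_intros)
  have int: "integral {- pi..pi} (\<lambda>x. Re (a * (cis (of_int l * x) / dimer_B t x) + b * H x + b * H (x + pi)))
     = Re (a * geo l + b * K + b * K)" for a b l
    using has_integral_linear[OF has_integral_add[OF has_integral_add[OF has_integral_mult_right[OF intB]
        has_integral_mult_right[OF intH]] has_integral_mult_right[OF intH']] bounded_linear_Re]
    unfolding o_def by (rule integral_unique)
  have Re_scale: "Re (of_real r * z) = r * Re z" for r z by simp
  show ?thesis
  proof (cases "even k")
    case True
    have "integral {- pi..pi} (\<lambda>y. cos y * cos (of_int k * x + y) / dimer_denom t x y)
        = Re (of_real (2 * pi) * (cis (of_int k * x) / dimer_B t x) + of_real (- pi) * H x + of_real (- pi) * H (x + pi))" for x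
    proof -
      have sh: "cis (of_int k * (x + pi)) = cis (of_int k * x)"
        using True by (simp add: cis_int_shift_pi)
      have "of_real (2 * pi) * (2 * (cis (of_int k * x) / 2) / dimer_B t x
          + (cis (of_int k * x) / 2 * dimer_B t x - 2 * (cis (of_int k * x) / 2) * of_real (dimer_A t x))
             / (dimer_B t x * of_real (dimer_S t x)))
        = of_real (2 * pi) * (cis (of_int k * x) / dimer_B t x) + of_real pi * cis (of_int k * x) *
          ((dimer_B t x - 2 * of_real (dimer_A t x)) / (dimer_B t x * of_real (dimer_S t x)))"
        using dimer_B_nonzero[OF t, of x] dimer_S_pos[OF t, of x] by (simp add: divide_simps; simp add: algebra_simps)
      also have "\<dots> = of_real (2 * pi) * (cis (of_int k * x) / dimer_B t x) + of_real (- pi) * H x + of_real (- pi) * H (x + pi)"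
        unfolding dimer_G_partial_fractions[OF t] H_def sh by (simp add: algebra_simps)
      finally show ?thesis
        unfolding cos_mult_cos_add_double dimer_inner_integral[OF t] Re_scale[symmetric]
        by (rule arg_cong)
    qed
    then show ?thesis
      unfolding dimer_R_def H_def[symmetric] K_def[symmetric] geo_def[symmetric]
      using True by (simp only: int) (simp add: power2_eq_square field_simps)
  next
    case False
    have "t * integral {- pi..pi} (\<lambda>y. cos (x + y) * cos (of_int k * x + y) / dimer_denom t x y)
        = Re (of_real (2 * pi * t) * (cis (of_int (k + 1) * x) / dimer_B t x) + (\<i> * of_real pi) * H x + (\<i> * of_real pi) * H (x + pi))" for x
    proof -
      have sh: "cis (of_int k * (x + pi)) = - cis (of_int k * x)"
        using False by (simp add: cis_int_shift_pi)
      define e where "e = cis (of_int k * x)"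
      have e: "cis (of_int (k + 1) * x) = e * cis x" "cis (of_int (k - 1) * x) = e * cis (- x)"
        by (simp_all add: e_def cis_mult algebra_simps)
      \<comment> \<open>Sum and difference of the two angles have frequencies \<open>k + 1\<close>
        and \<open>k - 1\<close> in \<open>x\<close>, and only the sum contains \<open>y\<close>;
        hence \<open>k + 1\<close> in the part without \<open>dimer_S\<close>.\<close>
      have cc: "cos (x + y) * cos (of_int k * x + y) = Re (e * cis x / 2 * cis (2 * y) + e * cis (- x) / 2)" for y
      proof -
        have "e * cis x / 2 * cis (2 * y) = cis (of_int k * x + y + (x + y)) / 2"
          "e * cis (- x) / 2 = cis (of_int k * x + y - (x + y)) / 2"
          by (simp_all add: e_def cis_mult algebra_simps)
        moreover have "cos (x - x * of_int k) = cos (x * of_int k - x)"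
          by (metis cos_minus minus_diff_eq)
        ultimately show ?thesis
          by (simp only: cos_times_cos plus_complex.sel Re_divide_numeral cis.sel)
            (simp add: algebra_simps)
      qed
      have "t * integral {- pi..pi} (\<lambda>y. cos (x + y) * cos (of_int k * x + y) / dimer_denom t x y)
        = Re (of_real (2 * pi * t) * (2 * (e * cis x / 2) / dimer_B t x
          + (e * cis (- x) / 2 * dimer_B t x - 2 * (e * cis x / 2) * of_real (dimer_A t x))
             / (dimer_B t x * of_real (dimer_S t x))))"
        unfolding cc dimer_inner_integral[OF t] Re_scale by (simp only: mult_ac)
      also have "of_real (2 * pi * t) * (2 * (e * cis x / 2) / dimer_B t x
          + (e * cis (- x) / 2 * dimer_B t x - 2 * (e * cis x / 2) * of_real (dimer_A t x))
             / (dimer_B t x * of_real (dimer_S t x)))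
        = of_real (2 * pi * t) * (e * cis x / dimer_B t x) + of_real pi * e *
          (of_real t * (cis (- x) * dimer_B t x - 2 * cis x * of_real (dimer_A t x)) / (dimer_B t x * of_real (dimer_S t x)))"
        using dimer_B_nonzero[OF t, of x] dimer_S_pos[OF t, of x] by (simp add: divide_simps; simp add: algebra_simps)
      also have "\<dots> = of_real (2 * pi * t) * (e * cis x / dimer_B t x) + (\<i> * of_real pi) * H x + (\<i> * of_real pi) * H (x + pi)"
        unfolding dimer_G_partial_fractions[OF t] H_def sh e_def by (simp add: algebra_simps)
      finally show ?thesis unfolding e .
    qed
    then have "t * integral {- pi..pi} (\<lambda>x. integral {- pi..pi} (\<lambda>y. cos (x + y) * cos (of_int k * x + y) / dimer_denom t x y))
       = Re (of_real (2 * pi * t) * geo (k + 1) + (\<i> * of_real pi) * K + (\<i> * of_real pi) * K)"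
      unfolding Henstock_Kurzweil_Integration.integral_mult_right[symmetric] by (simp only: int)
    then show ?thesis
      unfolding dimer_R_def H_def[symmetric] K_def[symmetric] geo_def[symmetric]
      using False by (simp add: power2_eq_square field_simps)
  qed
qed

end

section \<open>Matrix entries as Fourier coefficients of the symbol\<close>

lemma integral_reflect_symmetric:
  fixes f :: "real \<Rightarrow> 'a :: real_normed_vector"
  shows "integral {- pi..pi} (\<lambda>x. f (- x)) = integral {- pi..pi} f"
  using Henstock_Kurzweil_Integration.integral_reflect_real[of pi "- pi" f] by simp

lemma cis_minus_pi_half: "cis (- (pi / 2)) = - \<i>"
  by (simp add: complex_eq_iff)

text \<open>Conjugating \<open>dimer_c\<close> reflects the angle. Realness lets the real part in
  \<open>dimer_R_eq\<close> be evaluated.\<close>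

lemma dimer_c_coeff_real: "Im (dimer_c_coeff t m) = 0"
proof -
  have "cnj (dimer_c t x * cis (- (of_int m * x))) = dimer_c t (- x) * cis (- (of_int m * (- x)))" for x
    by (simp add: dimer_c_def cis_cnj)
  then have "cnj (dimer_c_coeff t m) = dimer_c_coeff t m"
    unfolding dimer_c_coeff_def complex_cnj_mult integral_cnj
    using integral_reflect_symmetric[of "\<lambda>x. dimer_c t x * cis (- (of_int m * x))"] by simp
  then show ?thesis by (simp add: complex_eq_iff)
qed

lemma floor_half_int: "\<lfloor>of_int (2 * l) / (2 :: real)\<rfloor> = l" "\<lfloor>of_int (2 * l + 1) / (2 :: real)\<rfloor> = l"
  by (rule floor_unique; simp add: field_simps)+

context
  fixes t :: real
  assumes t: "0 < t" "t < 1"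
begin

text \<open>The shift turns cos into sin and sin into -cos. The linear factor becomes 1 - t e^{ix},
  which is -e^{ix} times the one in \<open>dimer_c\<close>.\<close>

lemma dimer_G_shift_half_pi: "dimer_G t (x + - (pi / 2)) = - (cis (- x) * dimer_c t x)"
proof -
  have "cis (x + - (pi / 2)) = - \<i> * cis x"
    unfolding cis_mult[symmetric] cis_minus_pi_half by simp
  then have "1 - \<i> * of_real t * cis (x + - (pi / 2)) = 1 - of_real t * cis x"
    by (simp add: complex_eq_iff)
  also have "\<dots> = - (cis x * (of_real t - cis (- x)))"
    by (simp add: algebra_simps cis_mult)
  finally have "1 - \<i> * of_real t * cis (x + - (pi / 2)) = - (cis x * (of_real t - cis (- x)))" .
  moreover have "a / (- (cis x * u) * v) = - (cis (- x) * (a / (u * v)))" for a u v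
    unfolding cis_inverse[symmetric] by (simp add: field_simps)
  ultimately show ?thesis
    by (simp add: dimer_G_def dimer_c_def dimer_S_def cos_diff sin_diff add.commute)
qed

text \<open>After a quarter-period shift the factor \<open>cis (- x)\<close> of
  \<open>dimer_G_shift_half_pi\<close> lowers the frequency by one, whence the index
  \<open>1 - k\<close>; the shifted exponential leaves a power of \<open>- \<i>\<close>.\<close>

lemma integral_cis_dimer_G:
  "integral {- pi..pi} (\<lambda>x. cis (of_int k * x) * dimer_G t x)
   = - (cis (- (of_int k * (pi / 2))) * (2 * of_real pi * dimer_c_coeff t (1 - k)))"
proof -
  let ?H = "\<lambda>x. cis (of_int k * x) * dimer_G t x"
  have "integral {- pi..pi} ?H = integral {- pi..pi} (\<lambda>x. ?H (x + - (pi / 2)))"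
    by (rule integral_period_shift[symmetric])
      (simp_all add: dimer_G_2pi[OF t] cis_add_2pi_multiple, intro continuous_intros continuous_dimer_G t)
  also have "(\<lambda>x. ?H (x + - (pi / 2)))
      = (\<lambda>x. - cis (- (of_int k * (pi / 2))) * (dimer_c t x * cis (- (of_int (1 - k) * x))))"
  proof
    fix x
    have "cis (of_int k * (x + - (pi / 2))) * cis (- x) = cis (- (of_int k * (pi / 2))) * cis (- (of_int (1 - k) * x))"
      by (simp add: cis_mult algebra_simps)
    then show "?H (x + - (pi / 2)) = - cis (- (of_int k * (pi / 2))) * (dimer_c t x * cis (- (of_int (1 - k) * x)))"
      unfolding dimer_G_shift_half_pi by (simp add: mult.assoc[symmetric]; simp add: mult_ac)
  qed
  finally show ?thesis
    by (simp add: dimer_c_coeff_def)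
qed

text \<open>Since \<open>dimer_B t x\<close> is 1 - q e^{2ix} with q = -t^2, this is a geometric
  integral. The sign of the power of q is split off because it cancels against the sign in
  \<open>dimer_R_entry\<close>.\<close>

lemma integral_cis_over_dimer_B:
  "integral {- pi..pi} (\<lambda>x. cis (of_int (2 * l) * x) / dimer_B t x)
   = of_real (if l \<le> 0 then 2 * pi * (if even l then 1 else - 1) * t powi (- (2 * l)) else 0)"
proof -
  have "cmod (- of_real (t\<^sup>2)) < 1"
    using t by (simp add: norm_power power_less_one_iff)
  then have *: "integral {- pi..pi} (\<lambda>x. cis (of_int (2 * l) * x) / dimer_B t x)
     = (if even (2 * l) \<and> 2 * l \<le> 0 then 2 * of_real pi * (- of_real (t\<^sup>2)) ^ nat (- (2 * l) div 2) else 0)"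
    using integral_cis_geometric[of "- of_real (t\<^sup>2)" "2 * l"] by (simp add: dimer_B_def)
  show ?thesis
  proof (cases "l \<le> 0")
    case True
    then obtain p where p: "l = - int p" by (metis zle_iff_zadd add.commute add_0 minus_equation_iff eq_neg_iff_add_eq_0)
    have "t powi (- (2 * l)) = t ^ (2 * p)" unfolding p by (simp add: power_int_def nat_mult_distrib)
    moreover have "(- complex_of_real (t\<^sup>2)) ^ p = (if even p then 1 else - 1) * of_real (t ^ (2 * p))"
      by (simp add: power_mult)
    ultimately show ?thesis
      unfolding * unfolding p by simp
  next
    case False
    then show ?thesis unfolding * by simp
  qed
qed

text \<open>The alternating sign of the entry undoes the power of \<open>- \<i>\<close> in
  \<open>integral_cis_dimer_G\<close>, and the part without \<open>dimer_S\<close> contributes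
  -t^{j-k-1} exactly for j > k, which cancels the \<open>step\<close> term. The parity of
  \<open>k - j + 1\<close> selects the formula for \<open>dimer_R\<close>.\<close>

lemma dimer_R_entry_eq: "dimer_R_entry t j k = - dimer_c_coeff t (j - k)"
proof -
  define C where "C = Re (dimer_c_coeff t (j - k))"
  have C: "dimer_c_coeff t (j - k) = of_real C"
    using dimer_c_coeff_real[of t "j - k"] by (simp add: C_def complex_eq_iff)
  have C': "dimer_c_coeff t (1 - (k - j + 1)) = of_real C" by (simp add: C)
  have powi: "(- 1 :: real) powi l = (if even l then 1 else - 1)" for l
    by (simp add: power_int_minus_left)
  show ?thesis
  proof (cases "even (k - j + 1)")
    case True
    then obtain l where l: "k - j + 1 = 2 * l" by blast
    then have kj: "k - j = 2 * (l - 1) + 1" "j - k = 1 - 2 * l" by auto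
    define s :: real where "s = (if even l then 1 else - 1)"
    define g where "g = (if l \<le> 0 then 2 * pi * s * t powi (- (2 * l)) else 0)"
    have ss: "s * s = 1" by (simp add: s_def)
    have cis: "cis (- (of_int (2 * l) * (pi / 2))) = of_real s"
      using cis_int_pi[of "- l"] by (simp add: s_def)
    have R: "dimer_R t (2 * l) = (g + s * (2 * pi * C)) / (4 * pi)"
      unfolding dimer_R_eq[OF t] integral_cis_dimer_G integral_cis_over_dimer_B cis C'[unfolded l]
      by (simp add: g_def s_def)
    \<comment> \<open>As \<open>k - j\<close> is odd, the floor is \<open>l - 1\<close> and not
      \<open>l\<close>; the resulting sign makes the geometric term cancel the \<open>step\<close>
      term instead of doubling it.\<close>
    have "\<lfloor>of_int (k - j) / (2 :: real)\<rfloor> = l - 1"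
      unfolding kj(1) by (rule floor_half_int)
    then have "dimer_R_entry t j k = of_real (2 * - s * dimer_R t (2 * l) + step (1 - 2 * l) * t powi (- (2 * l)))"
      unfolding dimer_R_entry_def l unfolding kj(2) by (simp add: powi s_def)
    also have "2 * - s * dimer_R t (2 * l) = - s * g / (2 * pi) - C"
      unfolding R using ss by (simp add: field_simps)
    also have "- s * g / (2 * pi) - C + step (1 - 2 * l) * t powi (- (2 * l)) = - C"
      using ss by (auto simp: g_def step_def)
    finally show ?thesis by (simp add: C)
  next
    case False
    then obtain l where l: "k - j + 1 = 2 * l + 1" by (rule oddE)
    then have kj: "k - j = 2 * l" "j - k = - (2 * l)" by auto
    define s :: real where "s = (if even l then 1 else - 1)"
    define g where "g = (if l + 1 \<le> 0 then 2 * pi * (- s) * t powi (- (2 * (l + 1))) else 0)"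
    have ss: "s * s = 1" by (simp add: s_def)
    \<comment> \<open>The odd multiple of \<open>pi / 2\<close> leaves one factor
      \<open>- \<i>\<close>, which the \<open>\<i>\<close> in the odd case of
      \<open>dimer_R_eq\<close> makes real.\<close>
    have "- (of_int (2 * l + 1) * (pi / 2)) = of_int (- l) * pi + - (pi / 2)" by (simp add: field_simps)
    then have "cis (- (of_int (2 * l + 1) * (pi / 2))) = cis (of_int (- l) * pi) * cis (- (pi / 2))"
      by (simp only: cis_mult)
    then have cis: "cis (- (of_int (2 * l + 1) * (pi / 2))) = - \<i> * of_real s"
      unfolding cis_minus_pi_half cis_int_pi by (simp add: s_def)
    have l1: "2 * l + 1 + 1 = 2 * (l + 1)" by simp
    have R: "dimer_R t (2 * l + 1) = (t * g - s * (2 * pi * C)) / (4 * pi)"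
      unfolding dimer_R_eq[OF t] integral_cis_dimer_G l1 integral_cis_over_dimer_B cis C'[unfolded l]
      by (simp add: g_def s_def)
    have "\<lfloor>of_int (k - j) / (2 :: real)\<rfloor> = l"
      unfolding kj(1) by (rule floor_half_int)
    then have "dimer_R_entry t j k = of_real (2 * s * dimer_R t (2 * l + 1) + step (- (2 * l)) * t powi (- (2 * l) - 1))"
      unfolding dimer_R_entry_def l unfolding kj(2) by (simp add: powi s_def)
    also have "2 * s * dimer_R t (2 * l + 1) = s * (t * g) / (2 * pi) - C"
      unfolding R using ss by (simp add: field_simps)
    also have "s * (t * g) / (2 * pi) - C + step (- (2 * l)) * t powi (- (2 * l) - 1) = - C"
    proof (cases "l < 0")
      case True
      \<comment> \<open>The prefactor \<open>t\<close> of the odd integral supplies the one missing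
        power of \<open>t\<close>.\<close>
      have "1 + - (2 * (l + 1)) = - (2 * l) - 1" by simp
      then have "t powi (- (2 * l) - 1) = t powi (1 + - (2 * (l + 1)))" by (rule arg_cong[OF sym])
      also have "\<dots> = t powi 1 * t powi (- (2 * (l + 1)))" by (rule power_int_add) (use t in simp)
      finally have tt: "t * t powi (- (2 * (l + 1))) = t powi (- (2 * l) - 1)"
        by (simp only: power_int_1_right)
      have "s * (t * g) / (2 * pi) = - (s * s * (t * t powi (- (2 * (l + 1)))))"
        using True by (simp add: g_def)
      then show ?thesis unfolding ss tt using True by (simp add: step_def)
    qed (simp add: g_def step_def)
    finally show ?thesis by (simp add: C)
  qed
qed

text \<open>The numerator is free of \<open>y\<close>, so only the moment of frequency zero
  enters.\<close>

lemma dimer_Q_odd: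
  assumes "odd k"
  shows "dimer_Q t k = 1 / (4 * pi) * integral {- pi..pi} (\<lambda>x. cos x * cos (of_int k * x) / dimer_S t x)"
proof -
  have "integral {- pi..pi} (\<lambda>y. cos x * cos (of_int k * x) / dimer_denom t x y)
      = 2 * pi * (cos x * cos (of_int k * x) / dimer_S t x)" for x
    using dimer_inner_integral[OF t, of 0 "of_real (cos x * cos (of_int k * x))" x] dimer_B_nonzero[OF t, of x]
    by (simp del: of_real_mult flip: of_real_divide)
  then show ?thesis
    using assms
    by (simp only: dimer_Q_def if_False Henstock_Kurzweil_Integration.integral_mult_right) (simp add: power2_eq_square)
qed

text \<open>A quarter-period shift turns sin into cos and leads to the integral of
  \<open>dimer_Q_odd\<close>. For even \<open>m\<close> both sides vanish.\<close>

lemma dimer_d_coeff_eq: "dimer_d_coeff t m = of_real (2 * dimer_Q t m) * cis (- (of_int m * (pi / 2)))"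
proof -
  define h where "h x = of_real (cos x / dimer_S t x) * cis (- (of_int m * x))" for x
  have nz: "sqrt (t\<^sup>2 + (sin x)\<^sup>2 + (sin x) ^ 4) \<noteq> 0" "sqrt (t\<^sup>2 + (cos x)\<^sup>2 + (cos x) ^ 4) \<noteq> 0" for x
    using dimer_S_pos[OF t, of x] dimer_S_pos[OF t, of "x - pi / 2"] by (auto simp: dimer_S_def cos_diff)
  have cis_2pi: "cis (- (of_int m * (x + 2 * pi))) = cis (- (of_int m * x))" for x
    using cis_add_2pi_multiple[of "- m" x] by simp
  have conth: "continuous_on UNIV h"
    unfolding h_def dimer_S_def using nz by (intro continuous_intros) auto
  have perh: "h (x + 2 * pi) = h x" for x
    by (simp add: h_def dimer_S_def cis_2pi)
  let ?d = "\<lambda>x. of_real (dimer_d t x) * cis (- (of_int m * x))"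
  have "integral {- pi..pi} ?d = integral {- pi..pi} (\<lambda>x. ?d (x + pi / 2))"
  proof (rule integral_period_shift[symmetric])
    show "continuous_on UNIV ?d" unfolding dimer_d_def using nz by (intro continuous_intros) auto
    show "?d (x + 2 * pi) = ?d x" for x by (simp only: cis_2pi) (simp add: dimer_d_def)
  qed simp
  also have "(\<lambda>x. ?d (x + pi / 2)) = (\<lambda>x. cis (- (of_int m * (pi / 2))) * h x)"
  proof
    fix x
    have "cis (- (of_int m * (x + pi / 2))) = cis (- (of_int m * (pi / 2))) * cis (- (of_int m * x))"
      by (simp add: cis_mult algebra_simps)
    then show "?d (x + pi / 2) = cis (- (of_int m * (pi / 2))) * h x"
      by (simp add: dimer_d_def h_def dimer_S_def sin_add)
  qed
  finally have d: "dimer_d_coeff t m = cis (- (of_int m * (pi / 2))) * integral {- pi..pi} h / (2 * of_real pi)"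
    by (simp add: dimer_d_coeff_def)
  show ?thesis
  proof (cases "even m")
    case True
    \<comment> \<open>A half-period shift changes the sign of cos but preserves even frequencies and
      \<open>dimer_S\<close>.\<close>
    have "h (x + pi) = - h x" for x
      using cis_int_shift_pi[of "- m" x] True by (simp add: h_def dimer_S_def)
    then have "integral {- pi..pi} h = - integral {- pi..pi} h"
      using integral_period_shift[OF conth perh, of pi] by simp
    then have "integral {- pi..pi} h = 0" by simp
    then show ?thesis using d True by (simp add: dimer_Q_def)
  next
    case False
    \<comment> \<open>Conjugation is reflection, because cos and \<open>dimer_S\<close> are even; so
      the integral is real.\<close>
    have "cnj (h x) = h (- x)" for x by (simp add: h_def cis_cnj dimer_S_def)
    then have "cnj (integral {- pi..pi} h) = integral {- pi..pi} h"
      unfolding integral_cnj by (simp add: integral_reflect_symmetric)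
    then have "integral {- pi..pi} h = of_real (Re (integral {- pi..pi} h))"
      by (simp add: complex_eq_iff)
    also have "Re (integral {- pi..pi} h) = integral {- pi..pi} (\<lambda>x. Re (h x))"
      using integral_linear[OF integrable_continuous_real[OF continuous_on_subset[OF conth]] bounded_linear_Re, of "- pi" pi]
      by (simp add: o_def)
    also have "(\<lambda>x. Re (h x)) = (\<lambda>x. cos x * cos (of_int m * x) / dimer_S t x)"
      by (simp add: h_def fun_eq_iff)
    finally show ?thesis
      unfolding d dimer_Q_odd[OF False] by simp
  qed
qed

text \<open>For an even index both sides vanish. For an odd one \<open>j + k\<close> and
  \<open>n\<close> have the same parity, so the power of \<open>- \<i>\<close> in
  \<open>dimer_d_coeff_eq\<close> is governed by the difference of the floors of their halves; the
  sign of the entry absorbs \<open>j + k\<close> and only the sign from \<open>n\<close> is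
  left.\<close>

lemma dimer_Q_entry_eq:
  "dimer_Q_entry t n j k = (- 1) ^ (n div 2) * dimer_d_coeff t (j + k - int n - 1)"
proof -
  define m where "m = j + k - int n - 1"
  have Q: "dimer_Q t (int n + 1 - j - k) = dimer_Q t m"
  proof -
    have m: "int n + 1 - j - k = - m" by (simp add: m_def)
    show ?thesis unfolding m by (simp add: dimer_Q_def)
  qed
  show ?thesis
  proof (cases "even m")
    case True
    then have "dimer_Q t m = 0" by (simp add: dimer_Q_def)
    then show ?thesis unfolding dimer_Q_entry_def Q dimer_d_coeff_eq m_def[symmetric] by simp
  next
    case False
    define a where "a = n div 2"
    obtain l where l: "j + k = 2 * l \<or> j + k = 2 * l + 1" by (metis evenE oddE)
    have m: "m = 2 * (l - int a) - 1"
      using l False unfolding m_def a_def by presburger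
    have "- (of_int m * (pi / 2)) = of_int (int a - l) * pi + pi / 2"
      unfolding m by (simp add: field_simps)
    then have "cis (- (of_int m * (pi / 2))) = (if even (int a - l) then 1 else - 1) * \<i>"
      by (simp only: cis_mult[symmetric] cis_int_pi cis_pi_half)
    moreover have "\<lfloor>of_int (j + k) / (2 :: real)\<rfloor> = l"
      using l floor_half_int by metis
    ultimately show ?thesis
      unfolding dimer_Q_entry_def Q dimer_d_coeff_eq m_def[symmetric] a_def[symmetric]
      by (auto simp: power_int_minus_left minus_one_power_iff)
  qed
qed

end

text \<open>Oddness of the sine carries over to the coefficients.\<close>

lemma dimer_d_coeff_minus: "dimer_d_coeff t (- m) = - dimer_d_coeff t m"
proof -
  have "integral {- pi..pi} (\<lambda>x. of_real (dimer_d t x) * cis (- (of_int (- m) * x)))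
      = integral {- pi..pi} (\<lambda>x. - (of_real (dimer_d t (- x)) * cis (- (of_int m * (- x)))))"
    by (simp add: dimer_d_def)
  then show ?thesis
    unfolding dimer_d_coeff_def Henstock_Kurzweil_Integration.integral_neg
    by (simp only: integral_reflect_symmetric[of "\<lambda>x. of_real (dimer_d t x) * cis (- (of_int m * x))"]) simp
qed

subsection \<open>The determinant\<close>

text \<open>The sign of \<open>p\<close> arises once from the rows and once from the columns. Every
  summand of the Leibniz formula takes one factor from each row and each column, so the scaling
  multiplies all summands by the same product.\<close>

lemma det_permute_scale:
  fixes A :: "'a :: comm_ring_1 mat"
  assumes A: "A \<in> carrier_mat N N" and p: "p permutes {0..<N}"
    and ab: "(\<Prod>i = 0..<N. a i) * (\<Prod>i = 0..<N. b i) = 1"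
  shows "Determinant.det (Matrix.mat N N (\<lambda>(i, j). a i * b j * A $$ (p i, p j))) = Determinant.det A"
proof -
  let ?R = "Matrix.mat N N (\<lambda>(i, j). A $$ (p i, j))"
  let ?P = "Matrix.mat N N (\<lambda>(i, j). A $$ (p i, p j))"
  have pN: "p i < N \<longleftrightarrow> i < N" for i
    using permutes_in_image[OF p] by simp
  \<comment> \<open>Columns are permuted as rows of the transpose.\<close>
  have "Determinant.det ?P = Determinant.det (transpose_mat ?P)"
    by (rule det_transpose[symmetric]) auto
  also have "transpose_mat ?P = Matrix.mat N N (\<lambda>(i, j). transpose_mat ?R $$ (p i, j))"
    by (rule eq_matI) (auto simp: pN)
  also have "Determinant.det \<dots> = signof p * Determinant.det (transpose_mat ?R)"
    by (rule det_permute_rows[OF _ p]) auto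
  also have "Determinant.det (transpose_mat ?R) = Determinant.det ?R"
    by (rule det_transpose) auto
  also have "Determinant.det ?R = signof p * Determinant.det A"
    by (rule det_permute_rows[OF A p])
  also have "signof p * (signof p * Determinant.det A) = Determinant.det A"
    by (simp add: sign_def)
  finally have P: "Determinant.det ?P = Determinant.det A" .
  have "(\<Prod>i = 0..<N. a i * b (q i) * A $$ (p i, p (q i))) = (\<Prod>i = 0..<N. A $$ (p i, p (q i)))"
    if q: "q permutes {0..<N}" for q
  proof -
    have "(\<Prod>i = 0..<N. b (q i)) = (\<Prod>i = 0..<N. b i)"
      using prod.permute[OF q, of b] by (simp add: o_def)
    then show ?thesis by (simp add: prod.distrib ab)
  qed
  moreover have "q i < N" if "q permutes {0..<N}" "i < N" for q i
    using permutes_in_image[OF that(1), of i] that(2) by simp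
  ultimately have "Determinant.det (Matrix.mat N N (\<lambda>(i, j). a i * b j * A $$ (p i, p j))) = Determinant.det ?P"
    unfolding Determinant.det_def by (auto intro!: sum.cong prod.cong)
  then show ?thesis using P by simp
qed

text \<open>The second block is also reversed: this turns $T_n(\tilde c)$ into $T_n(c)$ and $T_n(d)$ into the
  Hankel matrix to which \<open>dimer_Q_block\<close> is proportional.\<close>

definition block_interleave :: "nat \<Rightarrow> nat \<Rightarrow> nat" where
  "block_interleave n i = (if i < n then 2 * i else if i < 2 * n then 2 * (2 * n - 1 - i) + 1 else i)"

text \<open>The two halves take values of different parity, so collisions could occur only within
  one half, where the map is affine.\<close>

lemma block_interleave_permutes: "block_interleave n permutes {0..<2 * n}"
proof (rule bij_imp_permutes)
  have "inj_on (block_interleave n) {0..<2 * n}"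
    by (rule inj_onI) (auto simp: block_interleave_def split: if_splits; presburger)
  moreover have "block_interleave n ` {0..<2 * n} \<subseteq> {0..<2 * n}"
    by (auto simp: block_interleave_def)
  ultimately show "bij_betw (block_interleave n) {0..<2 * n} {0..<2 * n}"
    by (simp add: bij_betw_def endo_inj_surj)
qed (simp add: block_interleave_def)

text \<open>Periodicity makes the interval symmetric; then substituting -x turns the reflected
  function at index \<open>m\<close> into the plain one at \<open>- m\<close>. The minus sign in the
  last claim is the oddness of \<open>dimer_d\<close>.\<close>

lemma integral_dimer_c_full_period:
  assumes "0 < t" "t < 1"
  shows "1 / (2 * of_real pi) * integral {0..2 * pi} (\<lambda>x. dimer_c t x * cis (- (of_int m * x))) = dimer_c_coeff t m"
    and "1 / (2 * of_real pi) * integral {0..2 * pi} (\<lambda>x. of_real (dimer_d t x) * cis (- (of_int m * x))) = dimer_d_coeff t m"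
    and "1 / (2 * of_real pi) * integral {0..2 * pi} (\<lambda>x. dimer_c t (- x) * cis (- (of_int m * x))) = dimer_c_coeff t (- m)"
    and "1 / (2 * of_real pi) * integral {0..2 * pi} (\<lambda>x. of_real (dimer_d t (- x)) * cis (- (of_int m * x))) = - dimer_d_coeff t m"
proof -
  have nz: "sqrt (t\<^sup>2 + (sin x)\<^sup>2 + (sin x) ^ 4) \<noteq> 0" for x
    using dimer_S_pos[OF assms, of "x - pi / 2"] by (auto simp: dimer_S_def cos_diff)
  have nz': "complex_of_real t \<noteq> cis x" for x
    using assms by (metis abs_of_pos less_irrefl norm_cis norm_of_real)
  have contc: "continuous_on UNIV (dimer_c t)"
    unfolding dimer_c_def[abs_def] using nz nz' by (intro continuous_intros) auto
  have contd: "continuous_on UNIV (dimer_d t)"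
    unfolding dimer_d_def[abs_def] using nz by (intro continuous_intros) auto
  have per: "dimer_c t (x + 2 * pi) = dimer_c t x" "dimer_c t (- (x + 2 * pi)) = dimer_c t (- x)"
    "dimer_d t (x + 2 * pi) = dimer_d t x" "dimer_d t (- (x + 2 * pi)) = dimer_d t (- x)"
    "cis (- (of_int m * (x + 2 * pi))) = cis (- (of_int m * x))" for x
  proof -
    show "dimer_c t (x + 2 * pi) = dimer_c t x" for x
      using cis_plus_2pi[of "- (x + 2 * pi)"] by (simp add: dimer_c_def)
    from this[of "- (x + 2 * pi)"] show "dimer_c t (- (x + 2 * pi)) = dimer_c t (- x)" by simp
    show "dimer_d t (x + 2 * pi) = dimer_d t x" for x by (simp add: dimer_d_def)
    from this[of "- (x + 2 * pi)"] show "dimer_d t (- (x + 2 * pi)) = dimer_d t (- x)" by simp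
    show "cis (- (of_int m * (x + 2 * pi))) = cis (- (of_int m * x))"
      using cis_add_2pi_multiple[of "- m" x] by simp
  qed
  have contc': "continuous_on UNIV (\<lambda>x. dimer_c t (- x))" and contd': "continuous_on UNIV (\<lambda>x. dimer_d t (- x))"
    by (intro continuous_on_compose2[OF contc] continuous_on_compose2[OF contd] continuous_intros; simp)+
  show "1 / (2 * of_real pi) * integral {0..2 * pi} (\<lambda>x. dimer_c t x * cis (- (of_int m * x))) = dimer_c_coeff t m"
    unfolding dimer_c_coeff_def
    by (subst integral_0_2pi_conv_symmetric) (simp_all only: per refl, intro continuous_intros contc)
  show "1 / (2 * of_real pi) * integral {0..2 * pi} (\<lambda>x. of_real (dimer_d t x) * cis (- (of_int m * x))) = dimer_d_coeff t m"
    unfolding dimer_d_coeff_def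
    by (subst integral_0_2pi_conv_symmetric) (simp_all only: per refl, intro continuous_intros contd)
  have "integral {- pi..pi} (\<lambda>x. dimer_c t (- x) * cis (- (of_int m * x)))
      = integral {- pi..pi} (\<lambda>x. dimer_c t x * cis (- (of_int (- m) * x)))"
    using integral_reflect_symmetric[of "\<lambda>x. dimer_c t x * cis (- (of_int (- m) * x))"] by simp
  then show "1 / (2 * of_real pi) * integral {0..2 * pi} (\<lambda>x. dimer_c t (- x) * cis (- (of_int m * x))) = dimer_c_coeff t (- m)"
    unfolding dimer_c_coeff_def
    by (subst integral_0_2pi_conv_symmetric) (simp_all only: per refl, intro continuous_intros contc')
  have "integral {- pi..pi} (\<lambda>x. of_real (dimer_d t (- x)) * cis (- (of_int m * x)))
      = integral {- pi..pi} (\<lambda>x. of_real (dimer_d t x) * cis (- (of_int (- m) * x)))"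
    using integral_reflect_symmetric[of "\<lambda>x. of_real (dimer_d t x) * cis (- (of_int (- m) * x))"] by simp
  then show "1 / (2 * of_real pi) * integral {0..2 * pi} (\<lambda>x. of_real (dimer_d t (- x)) * cis (- (of_int m * x))) = - dimer_d_coeff t m"
    unfolding dimer_d_coeff_minus[symmetric] unfolding dimer_d_coeff_def
    by (subst integral_0_2pi_conv_symmetric) (simp_all only: per refl, intro continuous_intros contd')
qed

section \<open>Comparison of the two matrices\<close>

lemma dimer_matrix_index:
  assumes "i < 2 * n" "j < 2 * n"
  shows "dimer_matrix t n $$ (i, j) =
    (if i < n
     then if j < n then dimer_R_entry t (int i + 1) (int j + 1) else dimer_Q_entry t n (int i + 1) (int (j - n) + 1)
     else if j < n then dimer_Q_entry t n (int (i - n) + 1) (int j + 1)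
       else dimer_R_entry t (int (i - n) + 1) (int (j - n) + 1))"
  using assms by (auto simp: dimer_matrix_def dimer_R_block_def dimer_Q_block_def)

theorem mainTheorem2:
  fixes t :: real and n :: nat and c d :: "complex \<Rightarrow> complex"
    and \<phi> :: "complex \<Rightarrow> complex mat"
  assumes "0 < t" and "t < 1" and "n \<ge> 1"
    and c: "\<And>x :: real. c (cis x) =
      of_real (t * cos x + (sin x)\<^sup>2)
        / ((of_real t - cis (- x)) * of_real (sqrt (t\<^sup>2 + (sin x)\<^sup>2 + (sin x) ^ 4)))"
    and d: "\<And>x :: real. d (cis x) =
      of_real (sin x / sqrt (t\<^sup>2 + (sin x)\<^sup>2 + (sin x) ^ 4))"
    and \<phi>: "\<And>z. cmod z = 1 \<Longrightarrow> \<phi> z = mat_of_rows_list 2 [[c z, d z], [reflect d z, reflect c z]]"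
  shows "Determinant.det (dimer_matrix t n) = Determinant.det (block_toeplitz 2 n \<phi>)"
proof -
  note t = assms(1,2)
  have cd: "c (cis x) = dimer_c t x" "d (cis x) = of_real (dimer_d t x)" for x
    unfolding c d dimer_c_def dimer_d_def by (rule refl)+
  have \<phi>_entry: "\<phi> (cis x) $$ (0, 0) = dimer_c t x" "\<phi> (cis x) $$ (0, 1) = of_real (dimer_d t x)"
    "\<phi> (cis x) $$ (1, 0) = of_real (dimer_d t (- x))" "\<phi> (cis x) $$ (1, 1) = dimer_c t (- x)" for x
    by (simp_all add: \<phi> mat_of_rows_list_def reflect_cis cd)
  have entry: "fourier_coeff 2 \<phi> m $$ (a, b)
      = 1 / (2 * of_real pi) * integral {0..2 * pi} (\<lambda>x. \<phi> (cis x) $$ (a, b) * cis (- (of_int m * x)))"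
    if "a < 2" "b < 2" for m a b
    using that by (simp add: fourier_coeff_def)
  have coeff: "fourier_coeff 2 \<phi> m $$ (0, 0) = dimer_c_coeff t m"
    "fourier_coeff 2 \<phi> m $$ (0, 1) = dimer_d_coeff t m"
    "fourier_coeff 2 \<phi> m $$ (1, 0) = - dimer_d_coeff t m"
    "fourier_coeff 2 \<phi> m $$ (1, 1) = dimer_c_coeff t (- m)" for m
  proof -
    have "0 < (2 :: nat)" "1 < (2 :: nat)" by simp_all
    then show "fourier_coeff 2 \<phi> m $$ (0, 0) = dimer_c_coeff t m"
      "fourier_coeff 2 \<phi> m $$ (0, 1) = dimer_d_coeff t m"
      "fourier_coeff 2 \<phi> m $$ (1, 0) = - dimer_d_coeff t m"
      "fourier_coeff 2 \<phi> m $$ (1, 1) = dimer_c_coeff t (- m)"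
      by (simp_all only: entry \<phi>_entry integral_dimer_c_full_period[OF t])
  qed
  let ?T = "block_toeplitz 2 n \<phi>"
  \<comment> \<open>The permuted Toeplitz blocks need the factor -1 on the diagonal, by
    \<open>dimer_R_entry_eq\<close>, and \<open>- \<eta>\<close> off it, by
    \<open>dimer_Q_entry_eq\<close>. Because \<open>\<eta> * \<eta> = 1\<close>, this pattern of
    signs is a product of row signs \<open>a\<close> and column signs \<open>b\<close>.\<close>
  define \<eta> :: complex where "\<eta> = - ((- 1) ^ (n div 2))"
  have \<eta>: "\<eta> * \<eta> = 1" by (simp add: \<eta>_def flip: power_add mult_2)
  define a b where "a i = (if i < n then - 1 else - \<eta>)" and "b i = (if i < n then 1 else \<eta>)" for i
  have T: "?T $$ (p, q) = fourier_coeff 2 \<phi> (int (p div 2) - int (q div 2)) $$ (p mod 2, q mod 2)"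
    if "p < 2 * n" "q < 2 * n" for p q
    using that by (simp add: block_toeplitz_def)
  have M: "dimer_matrix t n = Matrix.mat (2 * n) (2 * n)
      (\<lambda>(i, j). a i * b j * ?T $$ (block_interleave n i, block_interleave n j))"
  proof (rule eq_matI)
    fix i j
    assume "i < dim_row (Matrix.mat (2 * n) (2 * n)
        (\<lambda>(i, j). a i * b j * ?T $$ (block_interleave n i, block_interleave n j)))"
      and "j < dim_col (Matrix.mat (2 * n) (2 * n)
        (\<lambda>(i, j). a i * b j * ?T $$ (block_interleave n i, block_interleave n j)))"
    then have ij: "i < 2 * n" "j < 2 * n" by auto
    \<comment> \<open>The block index in the Toeplitz matrix, with the second half running
      backwards.\<close>
    define k where "k i = (if i < n then i else 2 * n - 1 - i)" for i
    have \<sigma>: "block_interleave n i div 2 = k i" "block_interleave n i mod 2 = (if i < n then 0 else 1)"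
      "block_interleave n i < 2 * n" if "i < 2 * n" for i
      using that by (auto simp: block_interleave_def k_def)
    have "?T $$ (block_interleave n i, block_interleave n j)
      = fourier_coeff 2 \<phi> (int (k i) - int (k j)) $$ (if i < n then 0 else 1, if j < n then 0 else 1)"
      using ij by (simp add: T \<sigma>)
    \<comment> \<open>In the lower right block the reversed order undoes the reflection of c. In the
      lower left block the coefficient is minus that of d at 2n - 1 - i - j, which oddness turns
      into the one at i + j + 1 - 2n.\<close>
    then have "dimer_matrix t n $$ (i, j) = a i * b j * ?T $$ (block_interleave n i, block_interleave n j)"
      unfolding dimer_matrix_index[OF ij] dimer_R_entry_eq[OF t] dimer_Q_entry_eq[OF t]
      using ij \<eta> coeff dimer_d_coeff_minus[of t "2 * int n - (1 + (int i + int j))"]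
      by (auto simp: a_def b_def k_def \<eta>_def of_nat_diff algebra_simps)
    then show "dimer_matrix t n $$ (i, j) = Matrix.mat (2 * n) (2 * n)
        (\<lambda>(i, j). a i * b j * ?T $$ (block_interleave n i, block_interleave n j)) $$ (i, j)"
      using ij by simp
  qed (auto simp: dimer_matrix_def dimer_R_block_def)
  have ab: "(\<Prod>i = 0..<2 * n. a i) * (\<Prod>i = 0..<2 * n. b i) = 1"
  proof -
    \<comment> \<open>The number \<open>2 * n\<close> of these factors is even, so their product is
      1.\<close>
    have "a i * b i = - 1" for i using \<eta> by (simp add: a_def b_def)
    then show ?thesis by (simp flip: prod.distrib)
  qed
  have T_carrier: "?T \<in> carrier_mat (2 * n) (2 * n)"
    by (simp add: block_toeplitz_def mult.commute)
  show ?thesis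
    unfolding M by (rule det_permute_scale[OF T_carrier block_interleave_permutes ab])
qed

end
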